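(* Let $N\in\mathbb{N}$, let $\boldsymbol u=(u_1,\dots,u_N)$ with $u_1<\cdots<u_N$ even integers, and let $\xi=\sum_{j=1}^N\delta_{u_j}$. Let $\boldsymbol S(t)=(S_1(t),\dots,S_N(t))$, $t\in\mathbb{N}_0$, have independent components, each a simple symmetric random walk on $\mathbb{Z}$, with $S_j(0)=u_j$. Then $$\frac{h(\boldsymbol S(t))}{h(\boldsymbol u)}=\mathcal{D}_\xi(t,\boldsymbol S(t)),\qquad t\in\mathbb{N}_0,$$ where $\mathcal{D}_\xi(t,\boldsymbol S(t))=\det_{1\le j,k\le N}[\mathcal{M}_\xi^{u_k}(t,S_j(t))]$.
   Context: $\mathbb{N}=\{1,2,\dots\}$, $\mathbb{N}_0=\{0\}\cup\mathbb{N}$. $h(\boldsymbol x)=\prod_{1\le j<k\le N}(x_k-x_j)$ is the Vandermonde determinant. Let $\widetilde S_1,\dots,\widetilde S_N$ be i.i.d. processes, independent of $\boldsymbol S$, with $\widetilde S_j(0)=0$ and $\widetilde S_j(t)=\widetilde\zeta_j(1)+\cdots+\widetilde\zeta_j(t)$, where the $\widetilde\zeta_j(s)$ are i.i.d. with the hyperbolic secant density $\frac{1}{2\cosh(\pi x/2)}$ on $\mathbb{R}$; $\widetilde{\mathrm{E}}$ denotes expectation over the $\widetilde S_j$ only. Put $Z_j(t)=S_j(t)+i\widetilde S_j(t)$, $$\Phi_\xi^{u_k}(z)=\prod_{1\le j\le N,\,j\ne k}\frac{z-u_j}{u_k-u_j}\ (z\in\mathbb{C}),\qquad \mathcal{M}_\xi^{u_k}(t,S_j(t))=\widetilde{\mathrm{E}}\big[\Phi_\xi^{u_k}(Z_j(t))\big].$$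 *)

theory Defs
  imports "HOL-Probability.Probability" "Jordan_Normal_Form.Determinant"
begin

text \<open>
  Indices run over \<open>{..<N}\<close> instead of \<open>{1..N}\<close>, so \<open>u 0, \<dots>, u (N - 1)\<close> are the
  points of the configuration; the time index of the increments \<open>\<zeta> j s\<close> starts at \<open>s = 1\<close>.
\<close>

definition vandermonde :: "nat \<Rightarrow> (nat \<Rightarrow> real) \<Rightarrow> real" where
  "vandermonde N x = (\<Prod>k<N. \<Prod>j<k. (x k - x j))"

definition simple_symmetric_walk :: "'a measure \<Rightarrow> int \<Rightarrow> (nat \<Rightarrow> 'a \<Rightarrow> int) \<Rightarrow> bool" where
  "simple_symmetric_walk M x X \<longleftrightarrow>
     (\<forall>t. X t \<in> measurable M (count_space UNIV)) \<and>
     (\<forall>\<omega>\<in>space M. X 0 \<omega> = x) \<and>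
     prob_space.indep_vars M (\<lambda>_. count_space UNIV) (\<lambda>t \<omega>. X (Suc t) \<omega> - X t \<omega>) UNIV \<and>
     (\<forall>t. distr M (count_space UNIV) (\<lambda>\<omega>. X (Suc t) \<omega> - X t \<omega>) =
            measure_pmf (pmf_of_set {-1, 1}))"

definition sech_density :: "real \<Rightarrow> real" where
  "sech_density x = 1 / (2 * cosh (pi * x / 2))"

definition sech_walk :: "(nat \<Rightarrow> nat \<Rightarrow> 'a \<Rightarrow> real) \<Rightarrow> nat \<Rightarrow> nat \<Rightarrow> 'a \<Rightarrow> real" where
  "sech_walk \<zeta> j t \<omega> = (\<Sum>s=1..t. \<zeta> j s \<omega>)"

definition \<Phi> :: "nat \<Rightarrow> (nat \<Rightarrow> int) \<Rightarrow> nat \<Rightarrow> complex \<Rightarrow> complex" where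
  "\<Phi> N u k z = (\<Prod>j\<in>{..<N} - {k}. (z - of_int (u j)) / (of_int (u k) - of_int (u j)))"

text \<open>
  Here \<open>x\<close> is the value of the walk \<open>S j t\<close>, held fixed: the expectation is over the
  hyperbolic secant walk only, so the integrand is \<open>\<Phi>\<close> at \<open>Z = S + \<i> S~\<close> with only the
  imaginary part integrated out.
\<close>

definition mart_fun ::
  "'a measure \<Rightarrow> nat \<Rightarrow> (nat \<Rightarrow> int) \<Rightarrow> (nat \<Rightarrow> nat \<Rightarrow> 'a \<Rightarrow> real) \<Rightarrow> nat \<Rightarrow> nat \<Rightarrow> nat \<Rightarrow> real \<Rightarrow> complex"
where
  "mart_fun M N u \<zeta> k j t x =
     (LINT \<omega>|M. \<Phi> N u k (complex_of_real x + \<i> * complex_of_real (sech_walk \<zeta> j t \<omega>)))"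

definition det_mart ::
  "'a measure \<Rightarrow> nat \<Rightarrow> (nat \<Rightarrow> int) \<Rightarrow> (nat \<Rightarrow> nat \<Rightarrow> 'a \<Rightarrow> real) \<Rightarrow> nat \<Rightarrow> (nat \<Rightarrow> real) \<Rightarrow> complex"
where
  "det_mart M N u \<zeta> t x = det (mat N N (\<lambda>(j, k). mart_fun M N u \<zeta> k j t (x j)))"

end

theory Submission
  imports Defs
begin

text \<open>
  Since the hyperbolic secant walks are identically distributed with finite moments, the
  expectation of \<open>(x + \<i> Y)\<^sup>n\<close> at a fixed time is one and the same monic polynomial
  \<open>P n\<close> of degree \<open>n\<close> in \<open>x\<close> for every walk \<open>Y\<close>. Expanding \<open>\<Phi>\<close> in powers of \<open>z\<close> factors the
  matrix as \<open>(P n (x j)) * C\<close>, where \<open>C\<close> holds the coefficients of the Lagrange basis at \<open>u\<close>.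
  The first determinant is the Vandermonde determinant of \<open>x\<close>, because the \<open>P n\<close> are monic, and
  \<open>C\<close> is inverse to the Vandermonde matrix of \<open>u\<close>.
\<close>

section \<open>Determinants of evaluated monic polynomials\<close>

lemma poly_altdef_lessThan:
  fixes p :: "'a :: comm_semiring_1 poly"
  assumes "degree p < n"
  shows "poly p x = (\<Sum>i<n. coeff p i * x ^ i)"
proof -
  have "poly p x = (\<Sum>i\<le>degree p. coeff p i * x ^ i)"
    by (rule poly_altdef)
  also have "\<dots> = (\<Sum>i<n. coeff p i * x ^ i)"
    using assms by (intro sum.mono_neutral_left) (auto simp: coeff_eq_0)
  finally show ?thesis .
qed

text \<open>The matrix of values is the matrix of powers times the matrix of coefficients, and the
  latter is upper triangular with unit diagonal, so it has determinant 1.\<close>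

lemma det_monic_polys_eq_det_powers:
  fixes x :: "nat \<Rightarrow> 'a :: comm_ring_1"
  assumes deg: "\<And>k. k < N \<Longrightarrow> degree (p k) = k" and monic: "\<And>k. k < N \<Longrightarrow> coeff (p k) k = 1"
  shows "Determinant.det (mat N N (\<lambda>(j, k). poly (p k) (x j))) =
         Determinant.det (mat N N (\<lambda>(j, k). x j ^ k))"
proof -
  define A where "A = mat N N (\<lambda>(j, k). x j ^ k)"
  define B where "B = mat N N (\<lambda>(i, k). coeff (p k) i)"
  have "mat N N (\<lambda>(j, k). poly (p k) (x j)) = A * B"
    by (rule eq_matI)
      (auto simp: A_def B_def scalar_prod_def poly_altdef_lessThan[of _ N] deg atLeast0LessThan
        mult.commute intro!: sum.cong)
  moreover have "Determinant.det B = prod_list (diag_mat B)"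
    by (rule det_upper_triangular[of _ N])
      (auto simp: B_def upper_triangular_def deg intro!: coeff_eq_0)
  moreover have "diag_mat B = map (\<lambda>_. 1) [0..<N]"
    by (auto simp: diag_mat_def B_def monic)
  moreover have "prod_list (map (\<lambda>_. 1 :: 'a) xs) = 1" for xs :: "nat list"
    by (induction xs) auto
  ultimately show ?thesis
    by (simp add: A_def det_mult[of _ N] B_def)
qed

lemma det_powers:
  fixes x :: "nat \<Rightarrow> 'a :: idom"
  shows "Determinant.det (mat N N (\<lambda>(j, k). x j ^ k)) = (\<Prod>k<N. \<Prod>j<k. x k - x j)"
proof -
  \<comment> \<open>These are the Newton polynomials at the nodes: \<open>p k\<close> vanishes at
    \<open>x j\<close> for \<open>j < k\<close>, which makes \<open>A\<close> lower triangular with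
    the inner products on its diagonal.\<close>
  define p where "p k = (\<Prod>i<k. [:- x i, 1:])" for k
  define A where "A = mat N N (\<lambda>(j, k). poly (p k) (x j))"
  have deg: "degree (p k) = k" for k
    by (simp add: p_def degree_prod_eq_sum_degree)
  have "Determinant.det (mat N N (\<lambda>(j, k). x j ^ k)) = Determinant.det A"
    unfolding A_def
  proof (rule det_monic_polys_eq_det_powers[symmetric])
    show "coeff (p k) k = 1" for k
      using lead_coeff_prod[of "\<lambda>i. [:- x i, 1:]" "{..<k}"] deg[of k] by (simp add: p_def)
  qed (rule deg)
  also have "\<dots> = prod_list (diag_mat A)"
    by (rule det_lower_triangular[of N]) (auto simp: A_def p_def poly_prod)
  also have "diag_mat A = map (\<lambda>k. \<Prod>j<k. x k - x j) [0..<N]"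
    by (simp add: diag_mat_def A_def p_def poly_prod)
  also have "prod_list \<dots> = (\<Prod>k<N. \<Prod>j<k. x k - x j)"
    by (subst prod.distinct_set_conv_list[symmetric]) (auto simp: atLeast0LessThan)
  finally show ?thesis .
qed

lemma det_monic_polys:
  fixes x :: "nat \<Rightarrow> 'a :: idom"
  assumes "\<And>k. k < N \<Longrightarrow> degree (p k) = k" and "\<And>k. k < N \<Longrightarrow> coeff (p k) k = 1"
  shows "Determinant.det (mat N N (\<lambda>(j, k). poly (p k) (x j))) = (\<Prod>k<N. \<Prod>j<k. x k - x j)"
  using det_monic_polys_eq_det_powers[of N p x] assms by (simp add: det_powers)

section \<open>Moments of the hyperbolic secant walks\<close>

lemma sech_density_nonneg [simp]: "sech_density x \<ge> 0"
  by (simp add: sech_density_def)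

lemma borel_measurable_sech_density [measurable]: "sech_density \<in> borel_measurable borel"
  unfolding sech_density_def cosh_def by measurable

text \<open>Follows from pi / 2 being at least 1 and twice cosh y being at least exp |y|. This
  exponential decay is what makes all moments finite.\<close>

lemma sech_density_le: "sech_density x \<le> exp (- \<bar>x\<bar>)"
proof -
  have "exp \<bar>x\<bar> \<le> exp \<bar>pi * x / 2\<bar>"
    using pi_ge_two using mult_right_mono[of 2 pi "\<bar>x\<bar>"] by (simp add: abs_mult)
  also have "\<dots> \<le> 2 * cosh \<bar>pi * x / 2\<bar>"
    by (simp add: cosh_def del: cosh_real_abs)
  also have "\<dots> = 2 * cosh (pi * x / 2)"
    by (simp only: cosh_real_abs)
  finally have "1 / (2 * cosh (pi * x / 2)) \<le> 1 / exp \<bar>x\<bar>"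
    by (intro divide_left_mono) auto
  then show ?thesis
    by (simp add: sech_density_def exp_minus field_simps)
qed

text \<open>On the positive half-line this is the Gamma integral with value \<open>fact n\<close>;
  evenness of the integrand covers the other half.\<close>

lemma integrable_abs_power_times_exp: "integrable lborel (\<lambda>x::real. \<bar>x\<bar> ^ n * exp (- \<bar>x\<bar>))"
proof -
  have "(\<integral>\<^sup>+x. ennreal (indicator {0..} x *\<^sub>R (\<bar>x\<bar> ^ n * exp (- \<bar>x\<bar>))) \<partial>lborel) =
        (\<integral>\<^sup>+x. ennreal (x ^ n * exp (- x)) * indicator {0..} x \<partial>lborel)"
    by (intro nn_integral_cong) (auto simp: indicator_def)
  also have "\<dots> = ennreal (fact n)"
    by (subst nn_intergal_power_times_exp_Ici) simp
  finally have "has_bochner_integral lborel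
      (\<lambda>x. indicator {0..} x *\<^sub>R (\<bar>x\<bar> ^ n * exp (- \<bar>x\<bar>)) :: real) (fact n)"
    by (intro has_bochner_integral_nn_integral) (auto simp: indicator_def)
  from has_bochner_integral_even_function[OF this] show ?thesis
    by (auto simp: has_bochner_integral_iff)
qed

lemma integrable_sech_density_power: "integrable lborel (\<lambda>x. sech_density x * x ^ n)"
  by (rule Bochner_Integration.integrable_bound[OF integrable_abs_power_times_exp[of n]])
    (auto simp: abs_mult power_abs sech_density_le mult.commute[of "sech_density _"]
      intro!: mult_left_mono)

definition sech_moment :: "nat \<Rightarrow> real" where
  "sech_moment n = (\<integral>x. sech_density x * x ^ n \<partial>lborel)"

text \<open>The recursion expands a power of increment plus earlier walk by the binomial theorem. No
  walk index occurs, so all walks share these moments. The start \<open>0 ^ n\<close> is the moment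
  of the constant 0, including \<open>0 ^ 0 = 1\<close>.\<close>

primrec sech_walk_moment :: "nat \<Rightarrow> nat \<Rightarrow> real" where
  "sech_walk_moment 0 n = 0 ^ n"
| "sech_walk_moment (Suc t) n =
     (\<Sum>k\<le>n. of_nat (n choose k) * (sech_moment k * sech_walk_moment t (n - k)))"

context prob_space
begin

text \<open>After binomial expansion, independence factors the expectation of each mixed
  product.\<close>

lemma moment_sum_indep:
  fixes X Y :: "'a \<Rightarrow> real"
  assumes ind: "indep_var borel X borel Y"
    and X: "\<And>n. integrable M (\<lambda>\<omega>. X \<omega> ^ n)" and Y: "\<And>n. integrable M (\<lambda>\<omega>. Y \<omega> ^ n)"
  shows "has_bochner_integral M (\<lambda>\<omega>. (X \<omega> + Y \<omega>) ^ n)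
    (\<Sum>k\<le>n. of_nat (n choose k) * (expectation (\<lambda>\<omega>. X \<omega> ^ k) * expectation (\<lambda>\<omega>. Y \<omega> ^ (n - k))))"
proof -
  have "has_bochner_integral M (\<lambda>\<omega>. X \<omega> ^ k * Y \<omega> ^ l)
          (expectation (\<lambda>\<omega>. X \<omega> ^ k) * expectation (\<lambda>\<omega>. Y \<omega> ^ l))" for k l
  proof -
    have "indep_var borel ((\<lambda>x. x ^ k) \<circ> X) borel ((\<lambda>x. x ^ l) \<circ> Y)"
      by (rule indep_var_compose[OF ind]) auto
    then have "indep_var borel (\<lambda>\<omega>. X \<omega> ^ k) borel (\<lambda>\<omega>. Y \<omega> ^ l)"
      by (simp add: o_def)
    from indep_var_integrable[OF this X Y] indep_var_lebesgue_integral[OF this X Y]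
    show ?thesis by (simp add: has_bochner_integral_iff)
  qed
  then show ?thesis
    unfolding binomial_ring
    by (intro has_bochner_integral_sum) (simp add: mult.assoc has_bochner_integral_mult_right)
qed

lemma has_moment_sech:
  assumes "distributed M lborel X sech_density"
  shows "has_bochner_integral M (\<lambda>\<omega>. X \<omega> ^ n) (sech_moment n)"
  using distributed_integrable[OF assms, of "\<lambda>x. x ^ n"] distributed_integral[OF assms, of "\<lambda>x. x ^ n"]
    integrable_sech_density_power[of n]
  by (simp add: has_bochner_integral_iff sech_moment_def)

lemma has_moment_sech_walk:
  assumes ind: "indep_vars (\<lambda>_. borel) (\<lambda>(j, s). \<zeta> j s) ({j} \<times> {1..})"
    and dens: "\<And>s. s \<ge> 1 \<Longrightarrow> distributed M lborel (\<zeta> j s) sech_density"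
  shows "has_bochner_integral M (\<lambda>\<omega>. sech_walk \<zeta> j t \<omega> ^ n) (sech_walk_moment t n)"
proof (induction t arbitrary: n)
  case 0
  show ?case by (simp add: sech_walk_def has_bochner_integral_iff prob_space)
next
  case (Suc t)
  have "indep_var borel (\<zeta> j (Suc t)) borel (sech_walk \<zeta> j t)"
  proof -
    \<comment> \<open>Independence is given for the family indexed by pairs, so the walk is first
      written as a sum over the image of \<open>Pair j\<close>.\<close>
    have "indep_var borel ((\<lambda>(j, s). \<zeta> j s) (j, Suc t))
            borel (\<lambda>\<omega>. \<Sum>i\<in>Pair j ` {1..t}. (\<lambda>(j, s). \<zeta> j s) i \<omega>)"
      by (rule indep_vars_sum) (auto intro!: indep_vars_subset[OF ind])
    then show ?thesis
      by (simp add: sum.reindex inj_on_def sech_walk_def[abs_def])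
  qed
  from moment_sum_indep[OF this, of n] Suc has_moment_sech[OF dens, of "Suc t"]
  show ?case
    by (simp add: has_bochner_integral_iff sech_walk_def add.commute)
qed

end

text \<open>The expectation of \<open>(x + \<i> Y)\<^sup>n\<close> as a polynomial in \<open>x\<close>, for \<open>Y\<close> with moments \<open>m\<close>.\<close>

definition mean_power_poly :: "(nat \<Rightarrow> real) \<Rightarrow> nat \<Rightarrow> complex poly" where
  "mean_power_poly m n =
     (\<Sum>k\<le>n. monom (of_nat (n choose k) * (\<i> ^ (n - k) * complex_of_real (m (n - k)))) k)"

lemma coeff_mean_power_poly:
  "coeff (mean_power_poly m n) k =
     (if k \<le> n then of_nat (n choose k) * (\<i> ^ (n - k) * complex_of_real (m (n - k))) else 0)"
  by (simp add: mean_power_poly_def coeff_sum)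

text \<open>The coefficient at \<open>n\<close> is \<open>m 0\<close>, so total mass 1 also makes
  the polynomial monic.\<close>

lemma degree_mean_power_poly: "m 0 = 1 \<Longrightarrow> degree (mean_power_poly m n) = n"
  by (intro antisym degree_le le_degree) (auto simp: coeff_mean_power_poly)

lemma has_integral_mean_power_poly:
  fixes Y :: "'a \<Rightarrow> real"
  assumes "\<And>n. has_bochner_integral M (\<lambda>\<omega>. Y \<omega> ^ n) (m n)"
  shows "has_bochner_integral M (\<lambda>\<omega>. (x + \<i> * complex_of_real (Y \<omega>)) ^ n)
           (poly (mean_power_poly m n) x)"
proof -
  have "has_bochner_integral M (\<lambda>\<omega>. complex_of_real (Y \<omega> ^ k)) (complex_of_real (m k))" for k
    by (rule has_bochner_integral_of_real[OF assms])
  then have "has_bochner_integral M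
    (\<lambda>\<omega>. \<Sum>k\<le>n. (of_nat (n choose k) * x ^ k * \<i> ^ (n - k)) * complex_of_real (Y \<omega> ^ (n - k)))
    (\<Sum>k\<le>n. (of_nat (n choose k) * x ^ k * \<i> ^ (n - k)) * complex_of_real (m (n - k)))"
    by (intro has_bochner_integral_sum has_bochner_integral_mult_right) auto
  then show ?thesis
    by (simp add: binomial_ring mean_power_poly_def poly_sum poly_monom power_mult_distrib mult_ac)
qed

section \<open>The Lagrange basis and the factored determinant\<close>

text \<open>The Lagrange basis as formal polynomials, whose coefficients become matrix entries; the
  denominators are collected into one scalar.\<close>

definition \<Phi>_poly :: "nat \<Rightarrow> (nat \<Rightarrow> int) \<Rightarrow> nat \<Rightarrow> complex poly" where
  "\<Phi>_poly N u k = Polynomial.smult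
     (inverse (\<Prod>j\<in>{..<N} - {k}. of_int (u k) - of_int (u j)))
     (\<Prod>j\<in>{..<N} - {k}. [:- of_int (u j), 1:])"

lemma poly_\<Phi>_poly: "poly (\<Phi>_poly N u k) z = \<Phi> N u k z"
  by (simp add: \<Phi>_poly_def \<Phi>_def poly_prod prod_dividef divide_inverse[of "prod _ _"] mult.commute)

lemma degree_\<Phi>_poly:
  assumes "k < N"
  shows "degree (\<Phi>_poly N u k) < N"
  using degree_smult_le[of "inverse (\<Prod>j\<in>{..<N} - {k}. complex_of_int (u k) - of_int (u j))"
      "\<Prod>j\<in>{..<N} - {k}. [:- complex_of_int (u j), 1:]"] assms
  by (simp add: \<Phi>_poly_def degree_prod_eq_sum_degree)

lemma \<Phi>_at_node:
  assumes inj: "inj_on u {..<N}" and "j < N" "k < N"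
  shows "\<Phi> N u k (of_int (u j)) = (if j = k then 1 else 0)"
proof (cases "j = k")
  case True
  \<comment> \<open>Distinct nodes exclude zero denominators, so each factor is a nonzero number
    divided by itself.\<close>
  have "u k \<noteq> u i" if "i \<in> {..<N} - {k}" for i
    using that \<open>k < N\<close> inj by (auto simp: inj_on_def)
  with True show ?thesis
    by (auto simp: \<Phi>_def intro!: prod.neutral)
next
  case False
  with assms have "j \<in> {..<N} - {k}" by auto
  with False show ?thesis
    by (auto simp: \<Phi>_def intro!: prod_zero)
qed

text \<open>Linearity of the integral separates the dependence on \<open>x\<close> from that on
  \<open>k\<close>, giving the shape of an entry of a matrix product.\<close>

lemma mart_fun_eq:
  assumes "\<And>n. has_bochner_integral M (\<lambda>\<omega>. sech_walk \<zeta> j t \<omega> ^ n) (m n)" and "k < N"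
  shows "mart_fun M N u \<zeta> k j t x =
    (\<Sum>n<N. poly (mean_power_poly m n) (complex_of_real x) * coeff (\<Phi>_poly N u k) n)"
proof -
  have "has_bochner_integral M
     (\<lambda>\<omega>. \<Sum>n<N. (of_real x + \<i> * of_real (sech_walk \<zeta> j t \<omega>)) ^ n * coeff (\<Phi>_poly N u k) n)
     (\<Sum>n<N. poly (mean_power_poly m n) (of_real x) * coeff (\<Phi>_poly N u k) n)"
    by (intro has_bochner_integral_sum has_bochner_integral_mult_left
        has_integral_mean_power_poly assms)
  then show ?thesis
    unfolding mart_fun_def poly_\<Phi>_poly[symmetric] poly_altdef_lessThan[OF degree_\<Phi>_poly[OF \<open>k < N\<close>]]
    by (simp add: has_bochner_integral_iff mult.commute)
qed

text \<open>The Lagrange basis is dual to evaluation at the nodes, so its coefficient matrix inverts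
  the matrix of powers of the nodes.\<close>

lemma det_\<Phi>_coeffs:
  assumes inj: "inj_on u {..<N}"
  shows "(\<Prod>k<N. \<Prod>j<k. complex_of_int (u k) - of_int (u j)) *
    Determinant.det (mat N N (\<lambda>(n, k). coeff (\<Phi>_poly N u k) n)) = 1"
proof -
  define V where "V = mat N N (\<lambda>(j, n). complex_of_int (u j) ^ n)"
  define C where "C = mat N N (\<lambda>(n, k). coeff (\<Phi>_poly N u k) n)"
  have "V * C = 1\<^sub>m N"
  proof (rule eq_matI)
    fix j k assume "j < dim_row (1\<^sub>m N :: complex mat)" "k < dim_col (1\<^sub>m N :: complex mat)"
    then have jk: "j < N" "k < N" by auto
    then have "(V * C) $$ (j, k) = (\<Sum>n<N. coeff (\<Phi>_poly N u k) n * of_int (u j) ^ n)"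
      by (simp add: V_def C_def scalar_prod_def atLeast0LessThan mult.commute)
    also have "\<dots> = \<Phi> N u k (of_int (u j))"
      by (simp add: poly_\<Phi>_poly[symmetric] poly_altdef_lessThan[OF degree_\<Phi>_poly[OF jk(2)]])
    finally show "(V * C) $$ (j, k) = 1\<^sub>m N $$ (j, k)"
      using \<Phi>_at_node[OF inj jk] jk by simp
  qed (auto simp: V_def C_def)
  then have "Determinant.det V * Determinant.det C = 1"
    using det_mult[of V N C] by (simp add: V_def C_def)
  then show ?thesis
    by (simp add: V_def C_def det_powers)
qed

text \<open>Since \<open>m\<close> is common to all \<open>j\<close>, column \<open>n\<close> of
  \<open>P\<close> consists of values of one monic polynomial, and \<open>det_monic_polys\<close>
  applies.\<close>

lemma det_mart_eq:
  assumes m: "\<And>j n. j < N \<Longrightarrow> has_bochner_integral M (\<lambda>\<omega>. sech_walk \<zeta> j t \<omega> ^ n) (m n)"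
    and m0: "m 0 = 1" and inj: "inj_on u {..<N}"
  shows "det_mart M N u \<zeta> t x =
    complex_of_real (vandermonde N x / vandermonde N (\<lambda>j. real_of_int (u j)))"
proof -
  define P where "P = mat N N (\<lambda>(j, n). poly (mean_power_poly m n) (complex_of_real (x j)))"
  define C where "C = mat N N (\<lambda>(n, k). coeff (\<Phi>_poly N u k) n)"
  have "mat N N (\<lambda>(j, k). mart_fun M N u \<zeta> k j t (x j)) = P * C"
    by (rule eq_matI)
      (auto simp: P_def C_def scalar_prod_def mart_fun_eq[OF m] atLeast0LessThan)
  then have "det_mart M N u \<zeta> t x = Determinant.det P * Determinant.det C"
    using det_mult[of P N C] by (simp add: det_mart_def P_def C_def)
  also have "Determinant.det P = complex_of_real (vandermonde N x)"
    unfolding P_def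
    by (subst det_monic_polys)
      (auto simp: degree_mean_power_poly m0 coeff_mean_power_poly vandermonde_def)
  also have "Determinant.det C = inverse (complex_of_real (vandermonde N (\<lambda>j. real_of_int (u j))))"
    using det_\<Phi>_coeffs[OF inj]
    \<comment> \<open>A product equal to 1 already identifies the inverse, so no separate proof that
      the Vandermonde product of \<open>u\<close> is nonzero is required.\<close>
    by (intro inverse_unique[symmetric]) (simp add: C_def vandermonde_def)
  finally show ?thesis by (simp add: divide_inverse)
qed

theorem mainTheorem7:
  fixes M :: "'a measure" and N :: nat and u :: "nat \<Rightarrow> int"
    and S :: "nat \<Rightarrow> nat \<Rightarrow> 'a \<Rightarrow> int" and \<zeta> :: "nat \<Rightarrow> nat \<Rightarrow> 'a \<Rightarrow> real"
  assumes prob: "prob_space M"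
    and N: "N \<ge> 1"
    and u_less: "\<And>j k. j < k \<Longrightarrow> k < N \<Longrightarrow> u j < u k"
    and u_even: "\<And>j. j < N \<Longrightarrow> even (u j)"
    and S_walk: "\<And>j. j < N \<Longrightarrow> simple_symmetric_walk M (u j) (S j)"
    and S_indep: "prob_space.indep_vars M (\<lambda>_. Pi\<^sub>M UNIV (\<lambda>_. count_space UNIV))
          (\<lambda>j \<omega> t. S j t \<omega>) {..<N}"
    and \<zeta>_indep: "prob_space.indep_vars M (\<lambda>_. borel) (\<lambda>(j, s). \<zeta> j s) ({..<N} \<times> {1..})"
    and \<zeta>_density: "\<And>j s. j < N \<Longrightarrow> s \<ge> 1 \<Longrightarrow> distributed M lborel (\<zeta> j s) sech_density"
    and S_\<zeta>_indep: "prob_space.indep_var M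
          (Pi\<^sub>M ({..<N} \<times> UNIV) (\<lambda>_. borel))
          (\<lambda>\<omega>. \<lambda>(j, t)\<in>{..<N} \<times> UNIV. real_of_int (S j t \<omega>))
          (Pi\<^sub>M ({..<N} \<times> UNIV) (\<lambda>_. borel))
          (\<lambda>\<omega>. \<lambda>(j, t)\<in>{..<N} \<times> UNIV. sech_walk \<zeta> j t \<omega>)"
  shows "\<forall>t. \<forall>\<omega>\<in>space M.
      complex_of_real (vandermonde N (\<lambda>j. real_of_int (S j t \<omega>)) / vandermonde N (\<lambda>j. real_of_int (u j)))
        = det_mart M N u \<zeta> t (\<lambda>j. real_of_int (S j t \<omega>))"
proof (intro allI ballI)
  fix t \<omega>
  interpret prob_space M by (rule prob)
  have "has_bochner_integral M (\<lambda>\<omega>. sech_walk \<zeta> j t \<omega> ^ n) (sech_walk_moment t n)"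
    if j: "j < N" for j n
    using j by (intro has_moment_sech_walk \<zeta>_density) (auto intro: indep_vars_subset[OF \<zeta>_indep])
  note moments = this
  \<comment> \<open>The zeroth moment is the total mass, read off from the walk with index 0, which
    exists because \<open>N \<ge> 1\<close>.\<close>
  moreover have "sech_walk_moment t 0 = 1"
    using moments[of 0 0] N by (simp add: has_bochner_integral_iff prob_space)
  moreover have "inj_on u {..<N}"
    by (rule linorder_inj_onI') (use u_less in fastforce)
  ultimately show "complex_of_real
      (vandermonde N (\<lambda>j. real_of_int (S j t \<omega>)) / vandermonde N (\<lambda>j. real_of_int (u j))) =
      det_mart M N u \<zeta> t (\<lambda>j. real_of_int (S j t \<omega>))"
    by (rule det_mart_eq[where m = "sech_walk_moment t", symmetric])
qed

end
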